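(* Let $n \in \{56, 96\}$ and let $C \subseteq \mathbb{F}_2^n$ be an extremal Type~II code of length $n$, with minimal nonzero weight $m$. Then $C$ is spanned (over $\mathbb{F}_2$) by its codewords of weight $m$, i.e. $C = \langle \{c \in C : \mathrm{wt}(c) = m\}\rangle$.
   Context: A (binary linear) code of length $n$ is a linear subspace of $\mathbb{F}_2^n$. The Hamming weight $\mathrm{wt}(c)$ is the number of coordinates $i$ with $c_i = 1$. The dual code is $C^\perp = \{c' \in \mathbb{F}_2^n : \sum_i c_i c'_i = 0 \text{ for all } c \in C\}$; $C$ is self-dual if $C = C^\perp$. A code is of Type~II if it is self-dual and doubly even, i.e. $4 \mid \mathrm{wt}(c)$ for all $c \in C$. A Type~II code of length $n$ is extremal if it has no nonzero codewords of weight less than $4\lfloor n/24\rfloor + 4$ (so its minimal nonzero weight is $4\lfloor n/24\rfloor+4$). *)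

theory Defs
  imports "HOL-Analysis.Cartesian_Space" "HOL-Library.Z2"
begin

text \<open>
  Words of length \<open>n\<close> over the two-element field are vectors of type \<open>bit ^ 'n\<close> with
  \<open>CARD('n) = n\<close>.
\<close>

definition linear_code :: "(bit ^ 'n) set \<Rightarrow> bool" where
  "linear_code C \<longleftrightarrow> vec.subspace C"

definition wt :: "bit ^ 'n \<Rightarrow> nat" where
  "wt c = card {i. c $ i = 1}"

definition dual_code :: "(bit ^ 'n) set \<Rightarrow> (bit ^ 'n) set" where
  "dual_code C = {c'. \<forall>c\<in>C. (\<Sum>i\<in>UNIV. c $ i * c' $ i) = 0}"

definition self_dual :: "(bit ^ 'n) set \<Rightarrow> bool" where
  "self_dual C \<longleftrightarrow> C = dual_code C"

definition doubly_even :: "(bit ^ 'n) set \<Rightarrow> bool" where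
  "doubly_even C \<longleftrightarrow> (\<forall>c\<in>C. 4 dvd wt c)"

definition type_II :: "(bit ^ 'n) set \<Rightarrow> bool" where
  "type_II C \<longleftrightarrow> linear_code C \<and> self_dual C \<and> doubly_even C"

definition extremal_type_II :: "(bit ^ 'n) set \<Rightarrow> bool" where
  "extremal_type_II C \<longleftrightarrow>
     type_II C \<and> \<not> (\<exists>c\<in>C. c \<noteq> 0 \<and> wt c < 4 * (CARD('n) div 24) + 4)"

text \<open>Unspecified when \<open>C\<close> has no nonzero word.\<close>

definition min_weight :: "(bit ^ 'n) set \<Rightarrow> nat" where
  "min_weight C = (LEAST w. \<exists>c\<in>C. c \<noteq> 0 \<and> wt c = w)"

end

theory Submission
  imports Defs
begin

text \<open>
  Let \<open>C\<close> be the code, \<open>n\<close> its length and \<open>m\<close> its minimum weight. If the words of weight \<open>m\<close>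
  spanned a proper subcode, some \<open>v\<close> outside \<open>C\<close> would be orthogonal to all of them; take \<open>v\<close> of
  least weight \<open>w\<close> in its coset. A polynomial in \<open>n - 2 * wt c\<close> that vanishes on all weights
  other than \<open>0\<close>, \<open>m\<close>, \<open>n - m\<close> and \<open>n\<close> turns, by Poisson summation, character sums over the
  minimum weight words into counts of short vectors in cosets of \<open>C\<close>. This bounds \<open>w\<close> by the degree
  (8 or 14) and shows that the character sum of a set \<open>J\<close> depends only on \<open>card J\<close>, for \<open>card J\<close> at
  most 3 or 5. A minimum weight word meets \<open>v\<close> in an even number of at most \<open>m / 2\<close> points,
  so a polynomial with suitable roots is nonnegative at every intersection number, whereas its sum
  computed from the character sums is negative. Only \<open>n = 56\<close>, \<open>w = 8\<close> survives: there exactly 104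
  minimum weight words meet \<open>v\<close> in 6 points, while counting words of weight 7 in the cosets of the
  sets \<open>v - {i}\<close> would require at least 296 of them.
\<close>

section \<open>Elementary symmetric functions of signs\<close>

definition esym :: "('a \<Rightarrow> int) \<Rightarrow> 'a set \<Rightarrow> nat \<Rightarrow> int" where
  "esym y V j = (\<Sum>J | J \<subseteq> V \<and> card J = j. \<Prod>i\<in>J. y i)"

lemma esym_0: "finite V \<Longrightarrow> esym y V 0 = 1"
proof -
  assume "finite V"
  then have "{J. J \<subseteq> V \<and> card J = 0} = {{}}"
    using finite_subset by fastforce
  then show ?thesis by (simp add: esym_def)
qed

lemma esym_empty_Suc: "esym y {} (Suc j) = 0"
proof -
  have "{J. J \<subseteq> {} \<and> card J = Suc j} = {}" by auto
  then show ?thesis unfolding esym_def by simp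
qed

lemma esym_insert_Suc:
  assumes "finite V" "a \<notin> V"
  shows "esym y (insert a V) (Suc j) = esym y V (Suc j) + y a * esym y V j"
proof -
  let ?S = "\<lambda>k. {J. J \<subseteq> V \<and> card J = k}"
  have fin: "finite (?S k)" for k using assms(1) by simp
  have finJ: "finite J" if "J \<subseteq> V" for J using assms(1) that finite_subset by blast
  have eq: "{J. J \<subseteq> insert a V \<and> card J = Suc j} = ?S (Suc j) \<union> insert a ` ?S j"
  proof (intro equalityI subsetI)
    fix J assume J: "J \<in> {J. J \<subseteq> insert a V \<and> card J = Suc j}"
    show "J \<in> ?S (Suc j) \<union> insert a ` ?S j"
    proof (cases "a \<in> J")
      case True
      then have "J = insert a (J - {a})" "J - {a} \<in> ?S j" using J by auto
      then show ?thesis by blast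
    next
      case False
      then show ?thesis using J by auto
    qed
  next
    fix J assume "J \<in> ?S (Suc j) \<union> insert a ` ?S j"
    then show "J \<in> {J. J \<subseteq> insert a V \<and> card J = Suc j}"
      using assms finJ by (auto simp: card_insert_if)
  qed
  have disj: "?S (Suc j) \<inter> insert a ` ?S j = {}" using assms(2) by auto
  have inj: "inj_on (insert a) (?S j)"
    using assms(2) by (auto simp: inj_on_def)
  have "esym y (insert a V) (Suc j)
      = esym y V (Suc j) + (\<Sum>J\<in>insert a ` ?S j. \<Prod>i\<in>J. y i)"
    unfolding esym_def eq using fin disj by (subst sum.union_disjoint) auto
  also have "(\<Sum>J\<in>insert a ` ?S j. \<Prod>i\<in>J. y i) = (\<Sum>J\<in>?S j. \<Prod>i\<in>insert a J. y i)"
    by (subst sum.reindex[OF inj]) simp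
  also have "\<dots> = (\<Sum>J\<in>?S j. y a * (\<Prod>i\<in>J. y i))"
    by (intro sum.cong refl prod.insert) (use assms(2) finJ in auto)
  finally show ?thesis by (simp add: esym_def sum_distrib_left)
qed

lemma esym_1: "finite V \<Longrightarrow> esym y V (Suc 0) = (\<Sum>i\<in>V. y i)"
  by (induction V rule: finite_induct)
     (simp_all add: esym_empty_Suc esym_insert_Suc esym_0)

text \<open>Since \<open>y i * y i = 1\<close>, multiplying a squarefree monomial by
  \<open>y i\<close> either adds \<open>i\<close> to its index set or deletes it. A set of size
  \<open>j + 2\<close> arises in \<open>j + 2\<close> ways, one of size \<open>j\<close> in
  \<open>card V - j\<close> ways. This is the three-term recurrence of the Krawtchouk
  polynomials.\<close>

lemma sum_mult_esym:
  assumes "finite V" and sq: "\<And>i. y i * y i = 1"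
  shows "(\<Sum>i\<in>V. y i) * esym y V (Suc j)
    = int (j + 2) * esym y V (Suc (Suc j)) + (int (card V) - int j) * esym y V j"
  using assms(1)
proof (induction V arbitrary: j rule: finite_induct)
  case empty
  then show ?case by (cases j) (simp_all add: esym_empty_Suc)
next
  case (insert a V)
  define s where "s = (\<Sum>i\<in>V. y i)"
  have s': "(\<Sum>i\<in>insert a V. y i) = y a + s" using insert by (simp add: s_def)
  have IH: "s * esym y V (Suc k)
      = int (k + 2) * esym y V (Suc (Suc k)) + (int (card V) - int k) * esym y V k" for k
    using insert.IH unfolding s_def .
  have card: "int (card (insert a V)) = int (card V) + 1" using insert by simp
  show ?case
  proof (cases j)
    case 0
    have "s = esym y V (Suc 0)" using insert by (simp add: esym_1 s_def)
    then have s0: "y a * s = y a * esym y V (Suc 0)" by simp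
    have "(y a + s) * (esym y V (Suc 0) + y a)
        = y a * esym y V (Suc 0) + y a * y a + s * esym y V (Suc 0) + y a * s"
      by (simp add: algebra_simps)
    also have "\<dots> = 2 * esym y V (Suc (Suc 0)) + int (card V) + 1 + 2 * (y a * esym y V (Suc 0))"
      using IH[of 0] s0 insert by (simp add: sq esym_0)
    finally show ?thesis
      unfolding s' card 0 using insert by (simp add: esym_insert_Suc esym_0 algebra_simps)
  next
    case (Suc k)
    have "(y a + s) * (esym y V (Suc j) + y a * esym y V j)
       = y a * esym y V (Suc j) + (y a * y a) * esym y V j
         + s * esym y V (Suc j) + y a * (s * esym y V j)"
      by (simp add: algebra_simps)
    also have "\<dots> = y a * esym y V (Suc j) + esym y V j
         + (int (j + 2) * esym y V (Suc (Suc j)) + (int (card V) - int j) * esym y V j)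
         + y a * (int (k + 2) * esym y V (Suc j) + (int (card V) - int k) * esym y V k)"
      using IH[of j] IH[of k] by (simp add: sq Suc)
    finally show ?thesis
      unfolding s' card using insert by (simp add: esym_insert_Suc Suc algebra_simps)
  qed
qed

section \<open>Expanding products of linear factors in elementary symmetric functions\<close>

fun comb_from :: "(nat \<Rightarrow> int) \<Rightarrow> nat \<Rightarrow> int list \<Rightarrow> int" where
  "comb_from f j [] = 0"
| "comb_from f j (x # xs) = x * f j + comb_from f (Suc j) xs"

lemma comb_from_sum:
  "comb_from (\<lambda>j. \<Sum>c\<in>A. f c j) k xs = (\<Sum>c\<in>A. comb_from (f c) k xs)"
  by (induction xs arbitrary: k) (simp_all add: sum.distrib sum_distrib_left)

lemma comb_from_mult:
  "comb_from (\<lambda>j. a * f j) k xs = a * comb_from f k xs"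
  by (induction xs arbitrary: k) (simp_all add: algebra_simps)

lemma comb_from_cong:
  "(\<And>j. k \<le> j \<Longrightarrow> j < k + length xs \<Longrightarrow> f j = g j) \<Longrightarrow> comb_from f k xs = comb_from g k xs"
  by (induction xs arbitrary: k) simp_all

lemma comb_from_zero:
  "(\<And>j. k \<le> j \<Longrightarrow> j < k + length xs \<Longrightarrow> f j = 0) \<Longrightarrow> comb_from f k xs = 0"
  by (induction xs arbitrary: k) simp_all

lemma comb_from_delta:
  "k \<le> i \<Longrightarrow> i < k + length xs \<Longrightarrow> comb_from (\<lambda>j. if j = i then 1 else 0) k xs = xs ! (i - k)"
proof (induction xs arbitrary: k)
  case (Cons x xs)
  show ?case
  proof (cases "i = k")
    case True
    then show ?thesis using comb_from_zero[of "Suc k" xs "\<lambda>j. if j = i then 1 else 0"] by simp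
  next
    case False
    then have "Suc k \<le> i" using Cons.prems by simp
    moreover from this have "i - k = Suc (i - Suc k)" by simp
    ultimately show ?thesis using Cons False by simp
  qed
qed simp

text \<open>
  Entry \<open>k\<close> of \<open>root_coeffs N R\<close> is the coefficient of the \<open>k\<close>-th elementary symmetric function of
  \<open>N\<close> signs with sum \<open>s\<close> in the product of all \<open>s - r\<close>; in \<open>mul_root\<close>, \<open>j\<close> is the index of the
  head of the list and \<open>a\<close> is the entry before it.
\<close>

fun mul_root :: "int \<Rightarrow> int \<Rightarrow> int \<Rightarrow> int \<Rightarrow> int list \<Rightarrow> int list" where
  "mul_root N r j a [] = [j * a]"
| "mul_root N r j a (x # xs)
    = (j * a + (N - j) * (case xs of [] \<Rightarrow> 0 | z # _ \<Rightarrow> z) - r * x) # mul_root N r (j + 1) x xs"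

fun root_coeffs :: "int \<Rightarrow> int list \<Rightarrow> int list" where
  "root_coeffs N [] = [1]"
| "root_coeffs N (r # R) = mul_root N r 0 0 (root_coeffs N R)"

lemma length_mul_root: "length (mul_root N r j a xs) = Suc (length xs)"
  by (induction xs arbitrary: j a) simp_all

lemma length_root_coeffs: "length (root_coeffs N R) = Suc (length R)"
  by (induction R) (simp_all add: length_mul_root)

text \<open>The recurrence couples neighbouring indices, so a window of coefficients starting at
  \<open>Suc j\<close> needs two boundary terms: \<open>a\<close>, just before the window, feeds
  \<open>e (Suc j)\<close>, and the head of the window would feed \<open>e j\<close>, which lies
  outside.\<close>

lemma comb_from_mul_root_Suc:
  assumes "\<And>j. s * e (Suc j) = int (j + 2) * e (Suc (Suc j)) + (N - int j) * e j"
  shows "comb_from e (Suc j) (mul_root N r (int (Suc j)) a xs)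
    = (s - r) * comb_from e (Suc j) xs + int (Suc j) * a * e (Suc j)
      - (N - int j) * (case xs of [] \<Rightarrow> 0 | z # _ \<Rightarrow> z) * e j"
proof (induction xs arbitrary: j a)
  case (Cons x xs)
  have "x * (s * e (Suc j)) = x * (int (j + 2) * e (Suc (Suc j)) + (N - int j) * e j)"
    using assms by simp
  then show ?case
    using Cons[of "Suc j" x] by (simp add: algebra_simps)
qed simp

lemma comb_from_root_coeffs:
  assumes "e 0 = 1" "e (Suc 0) = s"
    and "\<And>j. s * e (Suc j) = int (j + 2) * e (Suc (Suc j)) + (N - int j) * e j"
  shows "comb_from e 0 (root_coeffs N R) = (\<Prod>r\<leftarrow>R. s - r)"
proof (induction R)
  case (Cons r R)
  obtain x xs where x: "root_coeffs N R = x # xs"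
    using length_root_coeffs[of N R] by (cases "root_coeffs N R") auto
  \<comment> \<open>Index 0 is treated separately: the recurrence only covers
    \<open>s * e (Suc j)\<close>, while \<open>s * e 0 = e 1\<close>.\<close>
  have "comb_from e (Suc 0) (mul_root N r 1 x xs) = (s - r) * comb_from e (Suc 0) xs + x * s
      - N * (case xs of [] \<Rightarrow> 0 | z # _ \<Rightarrow> z)"
    using comb_from_mul_root_Suc[OF assms(3), of 0 r x xs] assms(1,2) by simp
  then have "comb_from e 0 (root_coeffs N (r # R)) = (s - r) * comb_from e 0 (root_coeffs N R)"
    using assms(1) by (simp add: x algebra_simps)
  then show ?case using Cons by simp
qed (simp add: assms)

section \<open>Characters\<close>

text \<open>The characters of the group of binary words, with words identified with their supports
  and addition with \<open>sym_diff\<close>.\<close>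

definition chi :: "'a set \<Rightarrow> 'a set \<Rightarrow> int" where
  "chi u c = (-1) ^ card (u \<inter> c)"

lemma chi_commute: "chi u c = chi c u"
  by (simp add: chi_def Int_commute)

lemma chi_empty [simp]: "chi {} c = 1" "chi u {} = 1"
  by (simp_all add: chi_def)

lemma chi_even: "even (card (u \<inter> c)) \<Longrightarrow> chi u c = 1"
  by (simp add: chi_def)

lemma chi_prod:
  assumes "finite u"
  shows "chi u c = (\<Prod>i\<in>u. if i \<in> c then -1 else 1)"
proof -
  have "(\<Prod>i\<in>u. if i \<in> c then -1 else 1) = (\<Prod>i\<in>u \<inter> c. -1 :: int)"
    by (rule prod.inter_restrict[OF assms, symmetric])
  then show ?thesis by (simp add: chi_def)
qed

lemma card_sym_diff:
  fixes u v :: "'a::finite set"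
  shows "card (sym_diff u v) + 2 * card (u \<inter> v) = card u + card v"
proof -
  have "card (sym_diff u v) = card (u - v) + card (v - u)"
    by (rule card_Un_disjoint) auto
  moreover have "card u = card (u - v) + card (u \<inter> v)"
    by (metis card_Int_Diff finite add.commute)
  moreover have "card v = card (v - u) + card (u \<inter> v)"
    by (metis card_Int_Diff finite add.commute inf_commute)
  ultimately show ?thesis by simp
qed

lemma even_card_sym_diff_Int:
  fixes u v c :: "'a::finite set"
  shows "even (card (sym_diff u v \<inter> c)) \<longleftrightarrow> even (card (u \<inter> c) + card (v \<inter> c))"
proof -
  have "sym_diff u v \<inter> c = sym_diff (u \<inter> c) (v \<inter> c)" by blast
  then show ?thesis
    using card_sym_diff[of "u \<inter> c" "v \<inter> c"] by (metis even_add even_mult_iff dvd_refl)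
qed

lemma chi_sym_diff:
  fixes u v c :: "'a::finite set"
  shows "chi (sym_diff u v) c = chi u c * chi v c"
  unfolding chi_def power_add[symmetric] minus_one_power_iff even_card_sym_diff_Int by simp

lemma sym_diff_cancel: "sym_diff (sym_diff u v) v = u"
  by blast

text \<open>Translation by \<open>c0\<close> permutes \<open>D\<close> and flips the sign of every
  term.\<close>

lemma sum_chi_zero:
  fixes D :: "'a::finite set set"
  assumes "c0 \<in> D" "\<And>c. c \<in> D \<Longrightarrow> sym_diff c c0 \<in> D" "odd (card (u \<inter> c0))"
  shows "(\<Sum>c\<in>D. chi u c) = 0"
proof -
  have "(\<Sum>c\<in>D. chi u c) = (\<Sum>c\<in>D. chi u (sym_diff c c0))"
    by (rule sum.reindex_bij_witness[where i = "\<lambda>c. sym_diff c c0" and j = "\<lambda>c. sym_diff c c0"])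
       (use assms(2) in \<open>auto simp: sym_diff_cancel\<close>)
  also have "\<dots> = (\<Sum>c\<in>D. - chi u c)"
    using assms(3) by (intro sum.cong refl)
      (simp add: chi_commute[of u] chi_sym_diff, simp add: chi_def Int_commute)
  finally show ?thesis by (simp add: sum_negf)
qed

lemma sum_signs_eq_card:
  assumes "finite V"
  shows "(\<Sum>i\<in>V. if i \<in> c then -1 else (1::int)) = int (card V) - 2 * int (card (c \<inter> V))"
proof -
  have "(\<Sum>i\<in>V. if i \<in> c then -1 else (1::int)) = (\<Sum>i\<in>V. 1 - 2 * (if i \<in> c then 1 else 0))"
    by (intro sum.cong) auto
  also have "\<dots> = int (card V) - 2 * (\<Sum>i\<in>V. if i \<in> c then 1 else 0)"
    by (simp add: sum_subtractf sum_distrib_left)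
  also have "(\<Sum>i\<in>V. if i \<in> c then 1 else (0::int)) = int (card (c \<inter> V))"
    using sum.inter_restrict[OF assms, of "\<lambda>_. 1::int" c] by (simp add: Int_commute)
  finally show ?thesis .
qed

text \<open>For signs that are -1 exactly on \<open>c\<close>, the elementary symmetric functions
  over \<open>V\<close> are sums of characters \<open>chi J c\<close>, and the signs add up to
  \<open>card V - 2 * card (c \<inter> V)\<close>.\<close>

lemma comb_from_chi:
  fixes V c :: "'a::finite set"
  shows "comb_from (\<lambda>j. \<Sum>J | J \<subseteq> V \<and> card J = j. chi J c) 0 (root_coeffs (int (card V)) R)
    = (\<Prod>r\<leftarrow>R. int (card V) - 2 * int (card (c \<inter> V)) - r)"
proof -
  define y :: "'a \<Rightarrow> int" where "y i = (if i \<in> c then -1 else 1)" for i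
  have "(\<lambda>j. \<Sum>J | J \<subseteq> V \<and> card J = j. chi J c) = esym y V"
    by (simp add: fun_eq_iff esym_def chi_prod y_def)
  moreover have "comb_from (esym y V) 0 (root_coeffs (int (card V)) R) = (\<Prod>r\<leftarrow>R. (\<Sum>i\<in>V. y i) - r)"
    by (rule comb_from_root_coeffs) (use sum_mult_esym[of V y] in \<open>simp_all add: esym_0 esym_1 y_def\<close>)
  ultimately show ?thesis by (simp add: y_def sum_signs_eq_card)
qed

text \<open>The hypothesis is the design property in Fourier form. It allows a polynomial of degree
  \<open>length R\<close> in the intersection numbers with \<open>V\<close> to be summed over
  \<open>D\<close> without knowing the individual numbers.\<close>

lemma sum_root_product_of_design:
  fixes V :: "'a::finite set"
  assumes "\<And>J. card J \<le> length R \<Longrightarrow> (\<Sum>c\<in>D. chi J c) = M (card J)"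
  shows "(\<Sum>c\<in>D. \<Prod>r\<leftarrow>R. int (card V) - 2 * int (card (c \<inter> V)) - r)
    = comb_from (\<lambda>j. int (card V choose j) * M j) 0 (root_coeffs (int (card V)) R)"
proof -
  have "(\<Sum>c\<in>D. \<Prod>r\<leftarrow>R. int (card V) - 2 * int (card (c \<inter> V)) - r)
     = comb_from (\<lambda>j. \<Sum>c\<in>D. \<Sum>J | J \<subseteq> V \<and> card J = j. chi J c) 0 (root_coeffs (int (card V)) R)"
    by (simp add: comb_from_sum comb_from_chi)
  also have "\<dots> = comb_from (\<lambda>j. int (card V choose j) * M j) 0 (root_coeffs (int (card V)) R)"
  proof (rule comb_from_cong)
    fix j assume "j < 0 + length (root_coeffs (int (card V)) R)"
    then have j: "j \<le> length R" by (simp add: length_root_coeffs)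
    have "(\<Sum>c\<in>D. \<Sum>J | J \<subseteq> V \<and> card J = j. chi J c) = (\<Sum>J | J \<subseteq> V \<and> card J = j. \<Sum>c\<in>D. chi J c)"
      by (rule sum.swap)
    also have "\<dots> = (\<Sum>J | J \<subseteq> V \<and> card J = j. M j)"
      by (intro sum.cong refl) (use assms j in auto)
    finally show "(\<Sum>c\<in>D. \<Sum>J | J \<subseteq> V \<and> card J = j. chi J c) = int (card V choose j) * M j"
      by (simp add: n_subsets)
  qed
  finally show ?thesis .
qed

text \<open>Double summation of \<open>chi u c\<close>: summing over \<open>D\<close> first leaves
  the \<open>u\<close> orthogonal to \<open>D\<close>, summing over all \<open>u\<close> first
  leaves only \<open>c = {}\<close>.\<close>

lemma card_mult_card_orthogonal:
  fixes D :: "'a::finite set set"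
  assumes "{} \<in> D" "\<And>c d. c \<in> D \<Longrightarrow> d \<in> D \<Longrightarrow> sym_diff c d \<in> D"
  shows "card D * card {u. \<forall>c\<in>D. even (card (u \<inter> c))} = 2 ^ CARD('a)"
proof -
  let ?O = "{u. \<forall>c\<in>D. even (card (u \<inter> c))}"
  have inner: "(\<Sum>c\<in>D. chi u c) = (if u \<in> ?O then int (card D) else 0)" for u
  proof (cases "u \<in> ?O")
    case True
    then show ?thesis by (simp add: chi_def)
  next
    case False
    then show ?thesis using sum_chi_zero[of _ D u] assms by auto
  qed
  have outer: "(\<Sum>u\<in>UNIV. chi u c) = (if c = {} then 2 ^ CARD('a) else 0)" for c :: "'a set"
  proof (cases "c = {}")
    case True
    then show ?thesis by (simp add: card_Pow flip: Pow_UNIV)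
  next
    case False
    then obtain i where "i \<in> c" by blast
    then have "(\<Sum>u\<in>UNIV. chi c u) = 0"
      by (intro sum_chi_zero[of "{i}"]) auto
    then show ?thesis using False by (simp add: chi_commute)
  qed
  have "int (card D * card ?O) = (\<Sum>u\<in>UNIV. \<Sum>c\<in>D. chi u c)"
    unfolding inner by (simp add: sum.If_cases)
  also have "\<dots> = (\<Sum>c\<in>D. \<Sum>u\<in>UNIV. chi u c)" by (rule sum.swap)
  also have "\<dots> = 2 ^ CARD('a)"
    unfolding outer using assms(1) by simp
  also have "\<dots> = int (2 ^ CARD('a))" by simp
  finally show ?thesis by (simp only: of_nat_eq_iff)
qed

section \<open>Doubly even self-dual families\<close>

text \<open>Words are represented by their supports. \<open>m\<close> is a lower bound for the
  nonzero weights; that it is attained comes out of the character sums.\<close>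

locale doubly_even_self_dual =
  fixes \<C> :: "'a::finite set set" and m :: nat
  assumes self_dual_iff: "u \<in> \<C> \<longleftrightarrow> (\<forall>c\<in>\<C>. even (card (u \<inter> c)))"
    and four_dvd: "c \<in> \<C> \<Longrightarrow> 4 dvd card c"
    and min_card: "c \<in> \<C> \<Longrightarrow> c \<noteq> {} \<Longrightarrow> m \<le> card c"
begin

definition minwords :: "'a set set" where
  "minwords = {c \<in> \<C>. card c = m}"

definition coset_count :: "'a set \<Rightarrow> nat \<Rightarrow> nat" where
  "coset_count v k = card {u. card u = k \<and> sym_diff u v \<in> \<C>}"

lemma empty_mem: "{} \<in> \<C>"
  by (subst self_dual_iff) simp

text \<open>Orthogonality to the code is preserved by sums, so self-duality brings
  linearity.\<close>

lemma sym_diff_mem: "c \<in> \<C> \<Longrightarrow> d \<in> \<C> \<Longrightarrow> sym_diff c d \<in> \<C>"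
  by (subst self_dual_iff) (simp add: even_card_sym_diff_Int self_dual_iff[THEN iffD1, rule_format])

lemma UNIV_mem: "UNIV \<in> \<C>"
proof -
  have "even (card (UNIV \<inter> c))" if "c \<in> \<C>" for c
    using four_dvd[OF that] by (metis Int_UNIV_left dvd_trans even_numeral)
  then show ?thesis using self_dual_iff by blast
qed

lemma sym_diff_UNIV: "sym_diff c UNIV = - c"
  by blast

lemma Compl_mem: "c \<in> \<C> \<Longrightarrow> - c \<in> \<C>"
  using sym_diff_mem[OF _ UNIV_mem, of c] unfolding sym_diff_UNIV .

lemma card_sq: "card \<C> * card \<C> = 2 ^ CARD('a)"
proof -
  have "{u. \<forall>c\<in>\<C>. even (card (u \<inter> c))} = \<C>" using self_dual_iff by blast
  then show ?thesis using card_mult_card_orthogonal[OF empty_mem sym_diff_mem] by simp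
qed

lemma sum_chi: "(\<Sum>c\<in>\<C>. chi u c) = (if u \<in> \<C> then int (card \<C>) else 0)"
proof (cases "u \<in> \<C>")
  case True
  then have "chi u c = 1" if "c \<in> \<C>" for c
    using that by (simp add: chi_even self_dual_iff[THEN iffD1, rule_format])
  then show ?thesis using True by simp
next
  case False
  then obtain c0 where "c0 \<in> \<C>" "odd (card (u \<inter> c0))" using self_dual_iff by blast
  then show ?thesis using sum_chi_zero[of c0 \<C> u] sym_diff_mem False by simp
qed

text \<open>Poisson summation: the sum over the code becomes a sum over low-weight coset vectors.\<close>

lemma sum_chi_root_product:
  "(\<Sum>c\<in>\<C>. chi v c * (\<Prod>r\<leftarrow>R. int CARD('a) - 2 * int (card c) - r))
    = int (card \<C>) * comb_from (\<lambda>k. int (coset_count v k)) 0 (root_coeffs (int CARD('a)) R)"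
proof -
  have "(\<Sum>c\<in>\<C>. chi v c * (\<Sum>J | J \<subseteq> UNIV \<and> card J = j. chi J c))
      = int (card \<C>) * int (coset_count v j)" for j
  proof -
    have "(\<Sum>c\<in>\<C>. chi v c * (\<Sum>J | J \<subseteq> UNIV \<and> card J = j. chi J c))
        = (\<Sum>c\<in>\<C>. \<Sum>J | card J = j. chi (sym_diff J v) c)"
      unfolding chi_sym_diff sum_distrib_left by (simp only: subset_UNIV simp_thms mult.commute)
    also have "\<dots> = (\<Sum>J | card J = j. \<Sum>c\<in>\<C>. chi (sym_diff J v) c)" by (rule sum.swap)
    also have "\<dots> = (\<Sum>J | card J = j. if sym_diff J v \<in> \<C> then int (card \<C>) else 0)"
      by (simp add: sum_chi)
    also have "\<dots> = int (card \<C>) * int (coset_count v j)"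
      by (simp add: sum.If_cases coset_count_def Collect_conj_eq)
    finally show ?thesis .
  qed
  then have "int (card \<C>) * comb_from (\<lambda>k. int (coset_count v k)) 0 (root_coeffs (int CARD('a)) R)
    = comb_from (\<lambda>j. \<Sum>c\<in>\<C>. chi v c * (\<Sum>J | J \<subseteq> UNIV \<and> card J = j. chi J c)) 0
        (root_coeffs (int CARD('a)) R)"
    by (simp only: comb_from_mult)
  also have "\<dots> = (\<Sum>c\<in>\<C>. chi v c * comb_from (\<lambda>j. \<Sum>J | J \<subseteq> UNIV \<and> card J = j. chi J c) 0
        (root_coeffs (int CARD('a)) R))"
    by (simp only: comb_from_sum comb_from_mult)
  also have "\<dots> = (\<Sum>c\<in>\<C>. chi v c * (\<Prod>r\<leftarrow>R. int CARD('a) - 2 * int (card c) - r))"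
    by (simp only: comb_from_chi[where V = UNIV] Int_UNIV_right)
  finally show ?thesis by simp
qed

lemma card_eq: "CARD('a) = 2 * h \<Longrightarrow> card \<C> = 2 ^ h"
proof -
  assume "CARD('a) = 2 * h"
  then have "card \<C> ^ 2 = (2 ^ h) ^ 2"
    using card_sq by (metis power2_eq_square power_mult mult.commute)
  then show ?thesis by (rule power_eq_imp_eq_base) simp_all
qed

lemma chi_Compl: "chi v (- c) = (-1) ^ card v * chi v c" for v c :: "'a set"
proof -
  have "chi (sym_diff c UNIV) v = chi c v * chi UNIV v" by (rule chi_sym_diff)
  then show ?thesis unfolding sym_diff_UNIV by (simp add: chi_commute) (simp add: chi_def)
qed

text \<open>
  The polynomial with roots \<open>R\<close> vanishes at all \<open>n - 2 * wt c\<close> except for words of weight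
  \<open>0\<close>, \<open>m\<close>, \<open>n - m\<close> and \<open>n\<close>, and at the latter it has the parity of \<open>p\<close>.
\<close>

definition isolating :: "int list \<Rightarrow> nat \<Rightarrow> bool" where
  "isolating R p \<longleftrightarrow>
    0 < m \<and> 2 * m < CARD('a) \<and>
    (\<forall>c\<in>\<C>. m < card c \<longrightarrow> card c + m < CARD('a) \<longrightarrow> int CARD('a) - 2 * int (card c) \<in> set R) \<and>
    (\<Prod>r\<leftarrow>R. - int CARD('a) - r) = (-1) ^ p * (\<Prod>r\<leftarrow>R. int CARD('a) - r) \<and>
    (\<Prod>r\<leftarrow>R. 2 * int m - int CARD('a) - r)
      = (-1) ^ p * (\<Prod>r\<leftarrow>R. int CARD('a) - 2 * int m - r)"

text \<open>Only \<open>{}\<close>, \<open>UNIV\<close>, the words in \<open>minwords\<close> and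
  their complements survive the roots. Complementing a word multiplies both \<open>chi v\<close> and
  the polynomial by \<open>(-1) ^ card v\<close>, so complementary words contribute equally; hence
  the factor 2.\<close>

lemma sum_chi_minwords:
  assumes "isolating R (card v)"
  shows "2 * ((\<Prod>r\<leftarrow>R. int CARD('a) - r)
      + (\<Prod>r\<leftarrow>R. int CARD('a) - 2 * int m - r) * (\<Sum>c\<in>minwords. chi v c))
    = int (card \<C>) * comb_from (\<lambda>k. int (coset_count v k)) 0 (root_coeffs (int CARD('a)) R)"
proof -
  define P where "P s = (\<Prod>r\<leftarrow>R. s - r)" for s :: int
  define f where "f c = chi v c * P (int CARD('a) - 2 * int (card c))" for c :: "'a set"
  let ?n = "int CARD('a)"
  have m: "0 < m" "2 * m < CARD('a)"
    and root: "\<And>c. c \<in> \<C> \<Longrightarrow> m < card c \<Longrightarrow> card c + m < CARD('a)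
      \<Longrightarrow> ?n - 2 * int (card c) \<in> set R"
    and Pn: "P (- ?n) = (-1) ^ card v * P ?n"
    and Pm: "P (2 * int m - ?n) = (-1) ^ card v * P (?n - 2 * int m)"
    using assms by (auto simp: isolating_def P_def)
  have sgn: "(-1) ^ card v * ((-1) ^ card v * x) = x" for x :: int
    by (cases "even (card v)") simp_all
  have card_Compl: "card (- c) = CARD('a) - card c" for c :: "'a set"
    by (simp add: Compl_eq_Diff_UNIV card_Diff_subset)
  have f_Compl: "f (- c) = f c" if "c = {} \<or> c \<in> minwords" for c
  proof -
    have "P (?n - 2 * int (card (- c))) = (-1) ^ card v * P (?n - 2 * int (card c))"
      using that Pn Pm m by (auto simp: card_Compl minwords_def of_nat_diff)
    then show ?thesis by (simp add: f_def chi_Compl sgn mult.left_commute mult.assoc)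
  qed
  have f_zero: "f c = 0" if "c \<in> \<C>" "c \<notin> {{}, UNIV} \<union> minwords \<union> uminus ` minwords" for c
  proof -
    have "card c \<noteq> m" using that by (simp add: minwords_def)
    moreover have "m \<le> card c" using that min_card by blast
    moreover have "- c \<notin> minwords" using that by (metis Un_iff double_compl imageI)
    then have "card (- c) \<noteq> m" using Compl_mem[OF that(1)] by (simp add: minwords_def)
    moreover have "m \<le> card (- c)" using that min_card Compl_mem by auto
    moreover have "card c \<le> CARD('a)" by (simp add: card_mono)
    ultimately have "?n - 2 * int (card c) \<in> set R"
      using that(1) root by (simp add: card_Compl)
    then have "P (?n - 2 * int (card c)) = 0" by (auto simp: P_def prod_list_zero_iff)
    then show ?thesis by (simp add: f_def)
  qed
  have sub: "{{}, UNIV} \<union> minwords \<union> uminus ` minwords \<subseteq> \<C>"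
    using empty_mem UNIV_mem Compl_mem by (auto simp: minwords_def)
  have "(\<Sum>c\<in>\<C>. f c) = (\<Sum>c\<in>{{}, UNIV} \<union> minwords \<union> uminus ` minwords. f c)"
    using sub f_zero by (intro sum.mono_neutral_right) auto
  also have "\<dots> = (\<Sum>c\<in>{{}, UNIV}. f c) + (\<Sum>c\<in>minwords. f c) + (\<Sum>c\<in>uminus ` minwords. f c)"
  proof -
    have d: "({{}, UNIV} \<union> minwords) \<inter> uminus ` minwords = {}"
    proof (intro equals0I, elim IntE imageE)
      fix x c assume x: "x \<in> {{}, UNIV} \<union> minwords" and "x = - c" "c \<in> minwords"
      then have "card x = CARD('a) - m" by (simp add: minwords_def card_Compl)
      moreover have "card x = 0 \<or> card x = CARD('a) \<or> card x = m"
        using x by (auto simp: minwords_def)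
      ultimately show False using m by auto
    qed
    have d': "{{}, UNIV} \<inter> minwords = {}"
      using m by (force simp: minwords_def)
    show ?thesis
      by (simp only: sum.union_disjoint[OF finite finite d] sum.union_disjoint[OF finite finite d'])
  qed
  also have "(\<Sum>c\<in>uminus ` minwords. f c) = (\<Sum>c\<in>minwords. f (- c))"
    by (subst sum.reindex) (auto simp: inj_on_def)
  also have "\<dots> = (\<Sum>c\<in>minwords. f c)"
    by (intro sum.cong refl f_Compl disjI2)
  also have "(\<Sum>c\<in>{{}, UNIV}. f c) = 2 * P ?n"
    using f_Compl[of "{}"] by (simp add: f_def)
  also have "(\<Sum>c\<in>minwords. f c) = P (?n - 2 * int m) * (\<Sum>c\<in>minwords. chi v c)"
    by (simp add: f_def minwords_def sum_distrib_left mult.commute)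
  finally show ?thesis
    using sum_chi_root_product[of v R] by (simp add: f_def P_def algebra_simps)
qed

section \<open>Character sums of small sets\<close>

lemma coset_count_near:
  assumes "card v + k < m"
  shows "coset_count v k = (if k = card v then 1 else 0)"
proof -
  have "u = v" if "card u = k" "sym_diff u v \<in> \<C>" for u
  proof -
    have "card (sym_diff u v) < m" using card_sym_diff[of u v] assms that by simp
    then have "sym_diff u v = {}" using min_card that(2) by (meson not_le)
    then show ?thesis by blast
  qed
  then have "{u. card u = k \<and> sym_diff u v \<in> \<C>} = (if k = card v then {v} else {})"
    using empty_mem by auto
  then show ?thesis by (simp add: coset_count_def)
qed

text \<open>Two vectors of one coset whose weights add up to less than \<open>m\<close> differ by
  the zero word. So \<open>v\<close> is the only vector of its coset with weight up to the degree,
  and Poisson summation determines the character sum, as in the Assmus-Mattson theorem.\<close>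

lemma sum_chi_minwords_near:
  assumes "isolating R (card v)" "card v \<le> length R" "card v + length R < m"
  shows "2 * ((\<Prod>r\<leftarrow>R. int CARD('a) - r)
      + (\<Prod>r\<leftarrow>R. int CARD('a) - 2 * int m - r) * (\<Sum>c\<in>minwords. chi v c))
    = int (card \<C>) * root_coeffs (int CARD('a)) R ! card v"
proof -
  let ?p = "root_coeffs (int CARD('a)) R"
  have "comb_from (\<lambda>k. int (coset_count v k)) 0 ?p
      = comb_from (\<lambda>k. if k = card v then 1 else 0) 0 ?p"
    by (rule comb_from_cong) (use assms in \<open>auto simp: coset_count_near length_root_coeffs\<close>)
  also have "\<dots> = ?p ! card v"
    using comb_from_delta[of 0 "card v" ?p] assms by (simp add: length_root_coeffs)
  finally show ?thesis using sum_chi_minwords[OF assms(1)] by simp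
qed

section \<open>Coset leaders orthogonal to the minimum weight words\<close>

definition orthogonal_leader :: "'a set \<Rightarrow> bool" where
  "orthogonal_leader v \<longleftrightarrow> v \<notin> \<C> \<and> (\<forall>c\<in>minwords. even (card (v \<inter> c))) \<and>
    (\<forall>u. sym_diff u v \<in> \<C> \<longrightarrow> card v \<le> card u)"

text \<open>The orthogonal complement \<open>E\<close> of a proper subcode \<open>D\<close> is
  larger than the code, because \<open>card D * card E\<close> is the square of
  \<open>card \<C>\<close>. A lightest vector of \<open>E - \<C>\<close> is lightest in its coset,
  since \<open>E - \<C>\<close> is a union of cosets.\<close>

lemma orthogonal_leader_exists:
  assumes "D \<subseteq> \<C>" "D \<noteq> \<C>" "minwords \<subseteq> D" "{} \<in> D"
    and "\<And>c d. c \<in> D \<Longrightarrow> d \<in> D \<Longrightarrow> sym_diff c d \<in> D"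
  obtains v where "orthogonal_leader v"
proof -
  define E where "E = {u. \<forall>c\<in>D. even (card (u \<inter> c))}"
  have "card D < card \<C>" using assms(1,2) by (simp add: psubsetI psubset_card_mono)
  moreover have "card D * card E = card \<C> * card \<C>"
    unfolding E_def card_sq by (rule card_mult_card_orthogonal) (use assms in auto)
  moreover have "0 < card \<C>" using calculation(1) by simp
  ultimately have "card \<C> < card E"
    by (metis leI less_le_not_le mult_le_mono2 mult_less_cancel2 order_less_le_trans)
  then have "\<not> E \<subseteq> \<C>" using card_mono[of \<C> E] by auto
  then obtain v0 where "v0 \<in> E - \<C>" by blast
  then obtain v where v: "v \<in> E - \<C>" and min: "\<And>u. u \<in> E - \<C> \<Longrightarrow> card v \<le> card u"
    using ex_has_least_nat[of "\<lambda>v. v \<in> E - \<C>" v0 card] by blast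
  have "card v \<le> card u" if u: "sym_diff u v \<in> \<C>" for u
  proof (rule min)
    have "even (card (u \<inter> c))" if c: "c \<in> D" for c
    proof -
      have "even (card (sym_diff u v \<inter> c))" using u c assms(1) self_dual_iff by blast
      moreover have "even (card (v \<inter> c))" using v c by (simp add: E_def)
      ultimately show ?thesis by (simp add: even_card_sym_diff_Int)
    qed
    moreover have "u \<notin> \<C>"
    proof
      assume "u \<in> \<C>"
      then have "sym_diff (sym_diff u v) u \<in> \<C>" using u sym_diff_mem by blast
      moreover have "sym_diff (sym_diff u v) u = v" by blast
      ultimately show False using v by simp
    qed
    ultimately show "u \<in> E - \<C>" by (simp add: E_def)
  qed
  then have "orthogonal_leader v" using v assms(3) by (auto simp: orthogonal_leader_def E_def)
  then show ?thesis by (rule that)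
qed

lemma orthogonal_leader_nonempty: "orthogonal_leader v \<Longrightarrow> v \<noteq> {}"
  using empty_mem by (auto simp: orthogonal_leader_def)

text \<open>Adding \<open>c\<close> to \<open>v\<close> stays in the coset and so cannot lower the
  weight.\<close>

lemma orthogonal_leader_Int_le:
  assumes "orthogonal_leader v" "c \<in> minwords"
  shows "2 * card (v \<inter> c) \<le> m"
proof -
  have "sym_diff (sym_diff v c) v = c" by blast
  then have "card v \<le> card (sym_diff v c)"
    using assms by (metis (no_types, lifting) orthogonal_leader_def mem_Collect_eq minwords_def)
  then show ?thesis using card_sym_diff[of v c] assms(2) by (simp add: minwords_def)
qed

lemma orthogonal_leader_chi: "orthogonal_leader v \<Longrightarrow> c \<in> minwords \<Longrightarrow> chi v c = 1"
  by (simp add: orthogonal_leader_def chi_even)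

text \<open>If the coset had no vector of weight up to the degree, the right side of the summation
  formula would be 0; but all characters \<open>chi v c\<close> are 1, which makes the left side
  positive.\<close>

lemma orthogonal_leader_card_le:
  assumes "orthogonal_leader v" "isolating R (card v)"
    and "(\<Prod>r\<leftarrow>R. int CARD('a) - r) > 0" "(\<Prod>r\<leftarrow>R. int CARD('a) - 2 * int m - r) > 0"
  shows "card v \<le> length R"
proof (rule ccontr)
  assume "\<not> card v \<le> length R"
  moreover have "coset_count v k = 0" if "k < card v" for k
    using assms(1) that by (force simp: coset_count_def orthogonal_leader_def)
  ultimately have "comb_from (\<lambda>k. int (coset_count v k)) 0 (root_coeffs (int CARD('a)) R) = 0"
    by (intro comb_from_zero) (simp add: length_root_coeffs)
  then have "(\<Prod>r\<leftarrow>R. int CARD('a) - r)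
      + (\<Prod>r\<leftarrow>R. int CARD('a) - 2 * int m - r) * int (card minwords) = 0"
    using sum_chi_minwords[OF assms(2)] orthogonal_leader_chi[OF assms(1)] by simp
  moreover have "(\<Prod>r\<leftarrow>R. int CARD('a) - 2 * int m - r) * int (card minwords) \<ge> 0"
    using assms(4) by (intro mult_nonneg_nonneg) simp_all
  ultimately show False using assms(3) by linarith
qed

subsection \<open>Length 56\<close>

text \<open>The roots are \<open>56 - 2 * k\<close> for the multiples \<open>k\<close> of 4 from 16
  to 40. They are symmetric, so the product is odd; doubling the root 0 makes it even.\<close>

lemma isolating_56:
  assumes "CARD('a) = 56" "m = 12"
  shows "odd p \<Longrightarrow> isolating [0, 8, -8, 16, -16, 24, -24] p"
    and "even p \<Longrightarrow> isolating [0, 0, 8, -8, 16, -16, 24, -24] p"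
proof -
  have "56 - 2 * int (card c) \<in> {0, 8, -8, 16, -16, 24, -24}"
    if "c \<in> \<C>" "12 < card c" "card c + 12 < 56" for c
  proof -
    obtain k where "card c = 4 * k" using four_dvd[OF \<open>c \<in> \<C>\<close>] by (elim dvdE)
    moreover from this have "k \<in> {4, 5, 6, 7, 8, 9, 10}" using that by auto
    ultimately show ?thesis by auto
  qed
  note root = this
  show "isolating [0, 8, -8, 16, -16, 24, -24] p" if "odd p"
    using root that unfolding isolating_def by (simp add: assms)
  show "isolating [0, 0, 8, -8, 16, -16, 24, -24] p" if "even p"
    using root that unfolding isolating_def by (simp add: assms)
qed

text \<open>The parity of \<open>card J\<close> selects degree 8 or 7, and degree plus
  \<open>card J\<close> stays below 12 exactly up to \<open>card J = 3\<close>. In other words, the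
  8190 words of weight 12 form a 3-design.\<close>

lemma sum_chi_minwords_56:
  assumes "CARD('a) = 56" "m = 12" "card J \<le> 3"
  shows "(\<Sum>c\<in>minwords. chi J c) = [8190, 4680, 2574, 1352] ! card J"
proof -
  have [simp]: "card \<C> = 2 ^ 28" by (rule card_eq) (simp add: assms)
  consider "card J = 0" | "card J = 1" | "card J = 2" | "card J = 3"
    using assms(3) by linarith
  then show ?thesis
  proof cases
    case 1
    then show ?thesis
      using sum_chi_minwords_near[OF isolating_56(2)[OF assms(1,2), of "card J"]] by (simp add: assms)
  next
    case 2
    then show ?thesis
      using sum_chi_minwords_near[OF isolating_56(1)[OF assms(1,2), of "card J"]] by (simp add: assms)
  next
    case 3
    then show ?thesis
      using sum_chi_minwords_near[OF isolating_56(2)[OF assms(1,2), of "card J"]] by (simp add: assms)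
  next
    case 4
    then show ?thesis
      using sum_chi_minwords_near[OF isolating_56(1)[OF assms(1,2), of "card J"]] by (simp add: assms)
  qed
qed

lemma no_orthogonal_leader_56:
  assumes n: "CARD('a) = 56" and m: "m = 12"
  shows "\<not> orthogonal_leader v"
proof
  assume v: "orthogonal_leader v"
  define w where "w = card v"
  have w_pos: "0 < w" using orthogonal_leader_nonempty[OF v] by (simp add: w_def card_gt_0_iff)
  have w_le: "w \<le> 8"
  proof (cases "even w")
    case True
    then show ?thesis
      using orthogonal_leader_card_le[OF v isolating_56(2)[OF n m]] by (simp add: n m w_def)
  next
    case False
    then show ?thesis
      using orthogonal_leader_card_le[OF v isolating_56(1)[OF n m]] by (simp add: n m w_def)
  qed
  have meet: "card (c \<inter> v) \<in> {0, 2, 4, 6}" if "c \<in> minwords" for c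
  proof -
    have "even (card (c \<inter> v))"
      using v that by (simp add: orthogonal_leader_def Int_commute)
    moreover have "card (c \<inter> v) \<le> 6"
      using orthogonal_leader_Int_le[OF v that] m by (simp add: Int_commute)
    moreover have "x \<in> {0, 2, 4, 6}" if "even x" "x \<le> 6" for x :: nat
    proof -
      obtain k where "x = 2 * k" using \<open>even x\<close> by (elim evenE)
      moreover from this have "k \<in> {0, 1, 2, 3}" using that by auto
      ultimately show ?thesis by auto
    qed
    ultimately show ?thesis by blast
  qed
  have moments: "(\<Sum>c\<in>minwords. \<Prod>r\<leftarrow>R. int w - 2 * int (card (c \<inter> v)) - r)
      = comb_from (\<lambda>j. int (w choose j) * ([8190, 4680, 2574, 1352] ! j)) 0 (root_coeffs (int w) R)"
    if "length R = 3" for R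
    unfolding w_def
    by (rule sum_root_product_of_design) (use that sum_chi_minwords_56[OF n m] in simp)
  \<comment> \<open>With \<open>x = card (c \<inter> v)\<close> the product is
    \<open>-2x * (4 - 2x) * (12 - 2x)\<close>: zero at 0, 2 and 6, and 128 at 4. Its sum computed
    from the moments is negative for \<open>w\<close> from 1 to 7.\<close>
  have "0 \<le> (\<Sum>c\<in>minwords. \<Prod>r\<leftarrow>[int w, int w - 4, int w - 12]. int w - 2 * int (card (c \<inter> v)) - r)"
    by (rule sum_nonneg) (use meet in fastforce)
  also have "\<dots> = comb_from (\<lambda>j. int (w choose j) * ([8190, 4680, 2574, 1352] ! j)) 0
      (root_coeffs (int w) [int w, int w - 4, int w - 12])"
    by (rule moments) simp
  finally have "0 \<le> comb_from (\<lambda>j. int (w choose j) * ([8190, 4680, 2574, 1352] ! j)) 0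
      (root_coeffs (int w) [int w, int w - 4, int w - 12])" .
  moreover have "w \<in> {1, 2, 3, 4, 5, 6, 7, 8}" using w_pos w_le by auto
  ultimately have w8: "w = 8"
    by (auto simp: numeral_eq_Suc)
  define N where "N = {c \<in> minwords. card (c \<inter> v) = 6}"
  \<comment> \<open>The roots 8, 4, 0 remove the intersection numbers 0, 2, 4; at 6 the value is
    \<open>(-12) * (-8) * (-4)\<close>.\<close>
  have "(\<Sum>c\<in>minwords. \<Prod>r\<leftarrow>[8, 4, 0]. 8 - 2 * int (card (c \<inter> v)) - r)
      = (\<Sum>c\<in>minwords. if card (c \<inter> v) = 6 then -384 else 0)"
    by (rule sum.cong) (use meet in fastforce)+
  also have "\<dots> = - 384 * int (card N)"
    by (simp add: N_def sum.If_cases Collect_conj_eq)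
  finally have "- 384 * int (card N)
      = comb_from (\<lambda>j. int (8 choose j) * ([8190, 4680, 2574, 1352] ! j)) 0 (root_coeffs 8 [8, 4, 0])"
    using moments[of "[8, 4, 0]"] by (simp only: w8 of_nat_numeral list.size)
  also have "\<dots> = - 39936"
    by (simp add: numeral_eq_Suc)
  finally have N: "card N = 104" by simp
  have count: "75 \<le> 1 + card {c \<in> N. i \<notin> c}" if i: "i \<in> v" for i
  proof -
    define u where "u = v - {i}"
    have card_u: "card u = 7" using i w8 by (simp add: u_def w_def)
    have chi_u: "chi u c = chi {i} c" if "c \<in> minwords" for c
    proof -
      have "u = sym_diff v {i}" using i by (auto simp: u_def)
      then show ?thesis using orthogonal_leader_chi[OF v that] by (simp add: chi_sym_diff)
    qed
    \<comment> \<open>Toggling \<open>i\<close> leads into the coset of \<open>v\<close>, where 8 is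
      the least weight; a vector containing \<open>i\<close> loses a point, any other gains
      one.\<close>
    have far: "7 \<le> card x" "i \<in> x \<Longrightarrow> 9 \<le> card x" if "sym_diff x u \<in> \<C>" for x
    proof -
      have "sym_diff (sym_diff x {i}) v = sym_diff x u" using i by (auto simp: u_def)
      then have "8 \<le> card (sym_diff x {i})"
        using v that w8 unfolding orthogonal_leader_def w_def by metis
      then show "7 \<le> card x" "i \<in> x \<Longrightarrow> 9 \<le> card x"
        using card_sym_diff[of x "{i}"] by simp_all
    qed
    have "card \<C> = 2 ^ 28" by (rule card_eq) (simp add: n)
    moreover have "coset_count u k = 0" if "k < 7" for k
      using far that by (force simp: coset_count_def)
    moreover have "(\<Sum>c\<in>minwords. chi u c) = 4680"
      using chi_u sum_chi_minwords_56[OF n m, of "{i}"] by simp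
    moreover have seven: "7 = Suc (Suc (Suc (Suc (Suc (Suc (Suc 0))))))" by simp
    \<comment> \<open>The polynomial has degree 7 and the coset of \<open>u\<close> nothing lighter
      than 7, so the formula has a single unknown, the number of vectors of weight 7.\<close>
    ultimately have B7: "coset_count u 7 = 75"
      unfolding seven
      using sum_chi_minwords[OF isolating_56(1)[OF n m, of "card u"]] by (simp add: card_u n m)
    \<comment> \<open>A vector of weight 7 other than \<open>u\<close> differs from \<open>u\<close>
      by a nonzero word of weight at most 14, hence 12, which meets \<open>u\<close> in 6 points and
      avoids \<open>i\<close>.\<close>
    have "{x. card x = 7 \<and> sym_diff x u \<in> \<C>}
        \<subseteq> insert u ((\<lambda>c. sym_diff c u) ` {c \<in> N. i \<notin> c})"
    proof
      fix x assume "x \<in> {x. card x = 7 \<and> sym_diff x u \<in> \<C>}"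
      then have x: "card x = 7" "sym_diff x u \<in> \<C>" by auto
      define c where "c = sym_diff x u"
      have xc: "x = sym_diff c u" by (auto simp: c_def)
      have ic: "i \<notin> c" using far(2)[OF x(2)] x(1) by (auto simp: c_def u_def)
      show "x \<in> insert u ((\<lambda>c. sym_diff c u) ` {c \<in> N. i \<notin> c})"
      proof (cases "c = {}")
        case True
        then show ?thesis using xc by simp
      next
        case False
        have "12 \<le> card c" "4 dvd card c"
          using min_card four_dvd x(2) False m by (simp_all add: c_def)
        moreover have "card c \<le> 14" using card_sym_diff[of x u] x(1) card_u by (simp add: c_def)
        ultimately have c12: "card c = 12" by presburger
        have "c \<inter> v = c \<inter> u" using ic by (auto simp: u_def)
        then have "card (c \<inter> v) = 6"
          using card_sym_diff[of c u] x(1) card_u c12 unfolding xc[symmetric] by simp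
        then have "c \<in> {c \<in> N. i \<notin> c}"
          using ic c12 x(2) m unfolding N_def minwords_def by (simp add: c_def)
        then show ?thesis using xc by blast
      qed
    qed
    then have "coset_count u 7 \<le> card (insert u ((\<lambda>c. sym_diff c u) ` {c \<in> N. i \<notin> c}))"
      unfolding coset_count_def by (intro card_mono) simp_all
    also have "\<dots> \<le> 1 + card ((\<lambda>c. sym_diff c u) ` {c \<in> N. i \<notin> c})"
      by (simp add: card_insert_le_m1 card_insert_if)
    also have "\<dots> \<le> 1 + card {c \<in> N. i \<notin> c}"
      by (simp add: card_image_le)
    finally show ?thesis by (simp only: B7)
  qed
  \<comment> \<open>Double counting pairs of a word in \<open>N\<close> and a point of
    \<open>v\<close> outside it: the total is 208, so adding 1 for each of 8 points gives 216, less
    than \<open>8 * 75\<close>.\<close>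
  have "(\<Sum>i\<in>v. card {c \<in> N. i \<notin> c}) = (\<Sum>c\<in>N. 2)"
  proof (rule sum_multicount_gen)
    show "\<forall>c\<in>N. card {i \<in> v. i \<notin> c} = 2"
    proof
      fix c assume "c \<in> N"
      then have "card (v \<inter> c) = 6" by (simp add: N_def Int_commute)
      moreover have "{i \<in> v. i \<notin> c} = v - c" by auto
      ultimately show "card {i \<in> v. i \<notin> c} = 2"
        using w8 card_Int_Diff[of v c] by (simp add: w_def)
    qed
  qed simp_all
  then have "(\<Sum>i\<in>v. 1 + card {c \<in> N. i \<notin> c}) = 216"
    unfolding sum.distrib using N w8 by (simp add: w_def)
  moreover have "(\<Sum>i\<in>v. 75) \<le> (\<Sum>i\<in>v. 1 + card {c \<in> N. i \<notin> c})"
    by (rule sum_mono) (rule count)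
  ultimately show False using w8 by (simp add: w_def)
qed

subsection \<open>Length 96\<close>

text \<open>The same construction for the weights 24 to 72, giving degrees 13 and 14.\<close>

lemma isolating_96:
  assumes "CARD('a) = 96" "m = 20"
  shows "odd p \<Longrightarrow> isolating [0, 8, -8, 16, -16, 24, -24, 32, -32, 40, -40, 48, -48] p"
    and "even p \<Longrightarrow> isolating [0, 0, 8, -8, 16, -16, 24, -24, 32, -32, 40, -40, 48, -48] p"
proof -
  have "96 - 2 * int (card c) \<in> {0, 8, -8, 16, -16, 24, -24, 32, -32, 40, -40, 48, -48}"
    if "c \<in> \<C>" "20 < card c" "card c + 20 < 96" for c
  proof -
    obtain k where "card c = 4 * k" using four_dvd[OF \<open>c \<in> \<C>\<close>] by (elim dvdE)
    moreover from this have "k \<in> {6..<19}" using that by simp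
    then have "k \<in> {6, 7, 8, 9, 10, 11, 12, 13, 14, 15, 16, 17, 18}"
      unfolding set_upt[symmetric] by simp
    ultimately show ?thesis by auto
  qed
  note root = this
  show "isolating [0, 8, -8, 16, -16, 24, -24, 32, -32, 40, -40, 48, -48] p" if "odd p"
    using root that unfolding isolating_def by (simp add: assms)
  show "isolating [0, 0, 8, -8, 16, -16, 24, -24, 32, -32, 40, -40, 48, -48] p" if "even p"
    using root that unfolding isolating_def by (simp add: assms)
qed

text \<open>Here degree plus \<open>card J\<close> stays below 20 exactly up to
  \<open>card J = 5\<close>: the 3217056 words of weight 20 form a 5-design.\<close>

lemma sum_chi_minwords_96:
  assumes "CARD('a) = 96" "m = 20" "card J \<le> 5"
  shows "(\<Sum>c\<in>minwords. chi J c) = [3217056, 1876616, 1072352, 598920, 326048, 172424] ! card J"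
proof -
  have [simp]: "card \<C> = 2 ^ 48" by (rule card_eq) (simp add: assms)
  note even_case = sum_chi_minwords_near[OF isolating_96(2)[OF assms(1,2), of "card J"]]
  note odd_case = sum_chi_minwords_near[OF isolating_96(1)[OF assms(1,2), of "card J"]]
  consider "card J = 0" | "card J = 1" | "card J = 2" | "card J = 3" | "card J = 4" | "card J = 5"
    using assms(3) by linarith
  then show ?thesis
  proof cases
    case 1
    then show ?thesis using even_case by (simp add: assms)
  next
    case 2
    then show ?thesis using odd_case by (simp add: assms)
  next
    case 3
    then show ?thesis using even_case by (simp add: assms)
  next
    case 4
    then show ?thesis using odd_case by (simp add: assms)
  next
    case 5
    then show ?thesis using even_case by (simp add: assms)
  next
    case 6
    then show ?thesis using odd_case by (simp add: assms)
  qed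
qed

lemma no_orthogonal_leader_96:
  assumes n: "CARD('a) = 96" and m: "m = 20"
  shows "\<not> orthogonal_leader v"
proof
  assume v: "orthogonal_leader v"
  define w where "w = card v"
  have w_pos: "0 < w" using orthogonal_leader_nonempty[OF v] by (simp add: w_def card_gt_0_iff)
  have w_le: "w \<le> 14"
  proof (cases "even w")
    case True
    then show ?thesis
      using orthogonal_leader_card_le[OF v isolating_96(2)[OF n m]] by (simp add: n m w_def)
  next
    case False
    then show ?thesis
      using orthogonal_leader_card_le[OF v isolating_96(1)[OF n m]] by (simp add: n m w_def)
  qed
  have meet: "card (c \<inter> v) \<in> {0, 2, 4, 6, 8, 10}" if "c \<in> minwords" for c
  proof -
    have "even (card (c \<inter> v))"
      using v that by (simp add: orthogonal_leader_def Int_commute)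
    moreover have "card (c \<inter> v) \<le> 10"
      using orthogonal_leader_Int_le[OF v that] m by (simp add: Int_commute)
    moreover have "x \<in> {0, 2, 4, 6, 8, 10}" if "even x" "x \<le> 10" for x :: nat
    proof -
      obtain k where "x = 2 * k" using \<open>even x\<close> by (elim evenE)
      moreover from this have "k \<in> {0, 1, 2, 3, 4, 5}" using that by auto
      ultimately show ?thesis by auto
    qed
    ultimately show ?thesis by blast
  qed
  let ?M = "[3217056, 1876616, 1072352, 598920, 326048, 172424] :: int list"
  \<comment> \<open>In terms of \<open>x = card (c \<inter> v)\<close> these roots sit at 0, 2, 4, 6
    and 10, and the product is positive at the remaining value 8. Degree 5 is what the design
    allows.\<close>
  let ?R = "[int w, int w - 4, int w - 8, int w - 12, int w - 20]"
  have "0 \<le> (\<Sum>c\<in>minwords. \<Prod>r\<leftarrow>?R. int w - 2 * int (card (c \<inter> v)) - r)"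
    by (rule sum_nonneg) (use meet in fastforce)
  also have "\<dots> = comb_from (\<lambda>j. int (w choose j) * ?M ! j) 0 (root_coeffs (int w) ?R)"
    unfolding w_def
    by (rule sum_root_product_of_design) (use sum_chi_minwords_96[OF n m] in simp)
  finally have "0 \<le> comb_from (\<lambda>j. int (w choose j) * ?M ! j) 0 (root_coeffs (int w) ?R)" .
  moreover have "w = 1 \<or> w \<in> {2..<15}" using w_pos w_le by auto
  then have "w \<in> {1, 2, 3, 4, 5, 6, 7, 8, 9, 10, 11, 12, 13, 14}"
    unfolding set_upt[symmetric] by simp
  ultimately show False
    by (auto simp: numeral_eq_Suc)
qed

end

section \<open>Words and their supports\<close>

definition support :: "bit ^ 'n \<Rightarrow> 'n set" where
  "support c = {i. c $ i = 1}"

lemma wt_eq_card_support: "wt c = card (support c)"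
  by (simp add: wt_def support_def)

lemma support_zero [simp]: "support 0 = {}"
  by (simp add: support_def)

lemma support_add: "support (c + d) = sym_diff (support c) (support d)"
proof -
  have "a + b = 1 \<longleftrightarrow> (a = 1) \<noteq> (b = 1)" for a b :: bit
    by (cases a; cases b) simp_all
  then show ?thesis by (auto simp: support_def)
qed

lemma inj_support: "inj support"
proof (rule injI)
  fix c d :: "bit ^ 'n" assume "support c = support d"
  then have "c $ i = 1 \<longleftrightarrow> d $ i = 1" for i by (auto simp: support_def)
  then have "c $ i = d $ i" for i by (metis bit_not_one_iff)
  then show "c = d" by (simp add: vec_eq_iff)
qed

lemma surj_support: "surj (support :: bit ^ 'n \<Rightarrow> 'n set)"
proof (rule surjI)
  show "support (\<chi> i. if i \<in> u then 1 else 0) = u" for u :: "'n set"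
    by (simp add: support_def)
qed

lemma sum_mult_bit_eq_zero_iff:
  "(\<Sum>i\<in>UNIV. c $ i * d $ i) = 0 \<longleftrightarrow> even (card (support c \<inter> support d))"
  for c d :: "bit ^ 'n"
proof -
  have mult: "a * b = (if a = 1 \<and> b = 1 then 1 else 0)" for a b :: bit
    by (cases a; cases b) simp_all
  have of_nat: "(of_nat k :: bit) = 0 \<longleftrightarrow> even k" for k
    by (induction k) simp_all
  have "(\<Sum>i\<in>UNIV. c $ i * d $ i) = (\<Sum>i\<in>UNIV. if i \<in> support c \<inter> support d then 1 else 0)"
    unfolding mult by (simp add: support_def)
  also have "\<dots> = (\<Sum>i\<in>UNIV \<inter> (support c \<inter> support d). 1)"
    by (rule sum.inter_restrict[symmetric]) simp
  also have "\<dots> = of_nat (card (support c \<inter> support d))"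
    by (simp only: sum_constant mult_1_right Int_UNIV_left)
  finally show ?thesis by (simp only: of_nat)
qed

lemma doubly_even_self_dual_support:
  fixes C :: "(bit ^ 'n) set"
  assumes "type_II C" "\<And>c. c \<in> C \<Longrightarrow> c \<noteq> 0 \<Longrightarrow> m \<le> wt c"
  shows "doubly_even_self_dual (support ` C) m"
proof
  fix u :: "'n set"
  obtain d where d: "u = support d" using surj_support by blast
  have "u \<in> support ` C \<longleftrightarrow> d \<in> C"
    by (simp add: d inj_image_mem_iff inj_support)
  also have "\<dots> \<longleftrightarrow> d \<in> dual_code C"
    using assms(1) by (simp add: type_II_def self_dual_def)
  also have "\<dots> \<longleftrightarrow> (\<forall>c\<in>support ` C. even (card (u \<inter> c)))"
    unfolding dual_code_def sum_mult_bit_eq_zero_iff d by (simp add: Int_commute)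
  finally show "u \<in> support ` C \<longleftrightarrow> (\<forall>c\<in>support ` C. even (card (u \<inter> c)))" .
next
  fix c assume "c \<in> support ` C"
  then show "4 dvd card c"
    using assms(1) by (auto simp: type_II_def doubly_even_def wt_eq_card_support)
next
  fix c assume "c \<in> support ` C" "c \<noteq> {}"
  then show "m \<le> card c"
    using assms(2) by (metis imageE support_zero wt_eq_card_support)
qed

section \<open>Transfer to codes and the spanning statement\<close>

lemma span_minwords:
  fixes C :: "(bit ^ 'n) set"
  assumes "type_II C" and min: "\<And>c. c \<in> C \<Longrightarrow> c \<noteq> 0 \<Longrightarrow> m \<le> wt c"
    and nm: "CARD('n) = 56 \<and> m = 12 \<or> CARD('n) = 96 \<and> m = 20"
  shows "C = vec.span {c \<in> C. wt c = m}" and "\<exists>c\<in>C. wt c = m"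
proof -
  interpret doubly_even_self_dual "support ` C" m
    using assms(1) min by (rule doubly_even_self_dual_support)
  have minwords: "minwords = support ` {c \<in> C. wt c = m}"
    by (auto simp: minwords_def wt_eq_card_support)
  \<comment> \<open>The character sum of the empty set counts the minimum weight words.\<close>
  have "int (card minwords) > 0"
    using nm sum_chi_minwords_56[of "{}"] sum_chi_minwords_96[of "{}"] by auto
  then show "\<exists>c\<in>C. wt c = m" by (auto simp: minwords card_gt_0_iff)
  define S where "S = vec.span {c \<in> C. wt c = m}"
  have "S \<subseteq> C"
    unfolding S_def using assms(1) by (intro vec.span_minimal) (auto simp: type_II_def linear_code_def)
  have "support ` S = support ` C"
  proof (rule ccontr)
    assume proper: "support ` S \<noteq> support ` C"
    have sub: "support ` S \<subseteq> support ` C" using \<open>S \<subseteq> C\<close> by blast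
    have min_sub: "minwords \<subseteq> support ` S"
      unfolding minwords S_def by (intro image_mono vec.span_superset)
    have zero: "{} \<in> support ` S"
      using imageI[OF vec.span_zero, of support] by (simp add: S_def)
    have closed: "sym_diff a b \<in> support ` S" if ab: "a \<in> support ` S" "b \<in> support ` S" for a b
    proof -
      obtain x y where "x \<in> S" "y \<in> S" "a = support x" "b = support y" using ab by blast
      moreover from this have "x + y \<in> S" unfolding S_def by (intro vec.span_add)
      then have "support (x + y) \<in> support ` S" by (rule imageI)
      ultimately show ?thesis by (simp only: support_add)
    qed
    obtain v where "orthogonal_leader v"
      by (rule orthogonal_leader_exists[OF sub proper min_sub zero closed])
    then show False
      using nm no_orthogonal_leader_56 no_orthogonal_leader_96 by blast
  qed
  then show "C = vec.span {c \<in> C. wt c = m}"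
    by (simp only: inj_image_eq_iff[OF inj_support] S_def)
qed

theorem theorem3p5:
  fixes C :: "(bit ^ 'n) set" and m :: nat
  assumes "CARD('n) \<in> {56, 96}"
    and "extremal_type_II C"
    and "m = min_weight C"
  shows "C = vec.span {c \<in> C. wt c = m}"
proof -
  define k where "k = 4 * (CARD('n) div 24) + 4"
  have C: "type_II C" and min: "\<And>c. c \<in> C \<Longrightarrow> c \<noteq> 0 \<Longrightarrow> k \<le> wt c"
    using assms(2) by (force simp: extremal_type_II_def k_def)+
  have nk: "CARD('n) = 56 \<and> k = 12 \<or> CARD('n) = 96 \<and> k = 20"
    using assms(1) by (auto simp: k_def)
  \<comment> \<open>Extremality only bounds the weights from below; a word attaining
    \<open>k\<close> identifies \<open>k\<close> with \<open>min_weight C\<close>.\<close>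
  obtain c where c: "c \<in> C" "wt c = k"
    using span_minwords(2)[OF C min nk] by blast
  moreover have "c \<noteq> 0" using c nk by (auto simp: wt_def)
  ultimately have "min_weight C = k"
    unfolding min_weight_def by (intro Least_equality) (use min in auto)
  then show ?thesis
    using span_minwords(1)[OF C min nk] assms(3) by simp
qed

end
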